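(* Let $\mathsf C$ be a Markov category with conditionals. Let $f:\Omega\to X$, $g:\Omega\to Y$, $u:X\to Z$, $v:Y\to Z$ be morphisms of $\mathcal S(\mathsf C)$ with $uf=vg$. If the square $(f,g,u,v)$ is independent, then so is the transposed square $(g,f,v,u)$, i.e. the square with top morphism $g:\Omega\to Y$, left morphism $f:\Omega\to X$, right morphism $v:Y\to Z$ and bottom morphism $u:X\to Z$.
   Context: A Markov category is a symmetric monoidal category $(\mathsf C,\otimes,I)$ (coherence isomorphisms suppressed) whose unit $I$ is terminal and in which every object $X$ carries a commutative comonoid structure $\mathrm{copy}_X:X\to X\otimes X$, $\mathrm{del}_X:X\to I$ compatible with the monoidal structure ($\mathrm{copy}_{X\otimes Y}$ is $\mathrm{copy}_X\otimes\mathrm{copy}_Y$ followed by the swap of the two middle factors, $\mathrm{del}_{X\otimes Y}=\mathrm{del}_X\otimes\mathrm{del}_Y$, and the structure on $I$ is trivial). The projections $\pi_X:X\otimes Y\to X$, $\pi_Y:X\otimes Y\to Y$ are obtained by deleting the other factor. For $f:A\to X$, $g:A\to Y$ write $\langle f,g\rangle=(f\otimes g)\circ\mathrm{copy}_A$ (similarly for triples, using iterated copy). A state is a morphism $p:I\to X$. $\mathsf C$ has conditionals if for every $f:A\to X\otimes Y$ there is $f|_X:X\otimes A\to Y$ with $f=(\mathrm{id}_X\otimes f|_X)\circ(\mathrm{copy}_X\otimes \mathrm{id}_A)\circ((\pi_X f)\otimes\mathrm{id}_A)\circ\mathrm{copy}_A$. For $f,g:X\to Y$ and a state $p:I\to X$,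 $f=_p g$ ($p$-almost sure equality) means $\langle \mathrm{id}_X,f\rangle\circ p=\langle\mathrm{id}_X,g\rangle\circ p$; $f$ is $p$-almost surely deterministic if $\mathrm{copy}_Y\circ f=_p(f\otimes f)\circ\mathrm{copy}_X$. The category $\mathcal P(\mathsf C)$ of probability spaces has objects $(\Omega,p)$ with $p:I\to\Omega$ a state; morphisms $(\Omega,p)\to(\Omega',q)$ are $p$-almost sure equality classes of $f:\Omega\to\Omega'$ with $f\circ p=q$; composition is that of $\mathsf C$ on representatives. The category $\mathcal S(\mathsf C)$ of sample spaces is the wide subcategory of $\mathcal P(\mathsf C)$ of classes of $p$-almost surely deterministic morphisms. A sample space is denoted by its underlying object $\Omega$, with state $p_\Omega$. A commutative square $(f,g,u,v)$ in $\mathcal S(\mathsf C)$ consisting of $f:\Omega\to X$, $g:\Omega\to Y$, $u:X\to Z$, $v:Y\to Z$ with $d:=uf=vg$ is called independent if there exist morphisms $\phi:Z\to X$ and $\psi:Z\to Y$ in $\mathsf C$ such that $\langle f,d,g\rangle\circ p_\Omega=\langle\phi,\mathrm{id}_Z,\psi\rangle\circ p_Z$ as states $I\to X\otimes Z\otimes Y$. *)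

theory Defs
  imports Main
begin

section \<open>Categories\<close>

record ('o, 'm) cat_struct =
  Obj :: "'o set"
  Arr :: "'m set"
  Dom :: "'m \<Rightarrow> 'o"
  Cod :: "'m \<Rightarrow> 'o"
  Ident :: "'o \<Rightarrow> 'm"
  Comp :: "'m \<Rightarrow> 'm \<Rightarrow> 'm"  (infixr "\<cdot>\<index>" 65)

definition hom :: "('o, 'm, 'z) cat_struct_scheme \<Rightarrow> 'o \<Rightarrow> 'o \<Rightarrow> 'm set" where
  "hom C A B = {f \<in> Arr C. Dom C f = A \<and> Cod C f = B}"

locale category =
  fixes C :: "('o, 'm, 'z) cat_struct_scheme" (structure)
  assumes dom_obj: "f \<in> Arr C \<Longrightarrow> Dom C f \<in> Obj C"
    and cod_obj: "f \<in> Arr C \<Longrightarrow> Cod C f \<in> Obj C"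
    and id_hom: "A \<in> Obj C \<Longrightarrow> Ident C A \<in> hom C A A"
    and comp_hom: "\<lbrakk>f \<in> hom C A B; g \<in> hom C B D\<rbrakk> \<Longrightarrow> g \<cdot> f \<in> hom C A D"
    and id_right: "f \<in> hom C A B \<Longrightarrow> f \<cdot> Ident C A = f"
    and id_left: "f \<in> hom C A B \<Longrightarrow> Ident C B \<cdot> f = f"
    and comp_assoc: "\<lbrakk>f \<in> hom C A B; g \<in> hom C B D; h \<in> hom C D E\<rbrakk>
      \<Longrightarrow> (h \<cdot> g) \<cdot> f = h \<cdot> (g \<cdot> f)"

definition inverse_arrows :: "('o, 'm, 'z) cat_struct_scheme \<Rightarrow> 'm \<Rightarrow> 'm \<Rightarrow> bool" where
  "inverse_arrows C f g \<longleftrightarrow> f \<in> Arr C \<and> g \<in> hom C (Cod C f) (Dom C f)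
     \<and> Comp C g f = Ident C (Dom C f) \<and> Comp C f g = Ident C (Cod C f)"

definition is_iso :: "('o, 'm, 'z) cat_struct_scheme \<Rightarrow> 'm \<Rightarrow> bool" where
  "is_iso C f \<longleftrightarrow> (\<exists>g. inverse_arrows C f g)"

definition inv_arr :: "('o, 'm, 'z) cat_struct_scheme \<Rightarrow> 'm \<Rightarrow> 'm" where
  "inv_arr C f = (THE g. inverse_arrows C f g)"


section \<open>Symmetric monoidal categories\<close>

text \<open>The coherence isomorphisms are explicit (the category is not assumed to be strict):
  \<open>Assoc C A B D : (A \<odot> B) \<odot> D \<rightarrow> A \<odot> (B \<odot> D)\<close>, \<open>Lunit C A : I \<odot> A \<rightarrow> A\<close>,
  \<open>Runit C A : A \<odot> I \<rightarrow> A\<close> and \<open>Sym C A B : A \<odot> B \<rightarrow> B \<odot> A\<close>.\<close>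

record ('o, 'm) smc_struct = "('o, 'm) cat_struct" +
  TensorObj :: "'o \<Rightarrow> 'o \<Rightarrow> 'o"  (infixr "\<odot>\<index>" 75)
  Tensor :: "'m \<Rightarrow> 'm \<Rightarrow> 'm"  (infixr "\<otimes>\<index>" 75)
  Unit :: "'o"
  Assoc :: "'o \<Rightarrow> 'o \<Rightarrow> 'o \<Rightarrow> 'm"
  Lunit :: "'o \<Rightarrow> 'm"
  Runit :: "'o \<Rightarrow> 'm"
  Sym :: "'o \<Rightarrow> 'o \<Rightarrow> 'm"

locale symmetric_monoidal_category = category C
  for C :: "('o, 'm, 'z) smc_struct_scheme" (structure) +
  assumes unit_obj: "Unit C \<in> Obj C"
    and tensor_obj: "\<lbrakk>A \<in> Obj C; B \<in> Obj C\<rbrakk> \<Longrightarrow> A \<odot> B \<in> Obj C"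
    and tensor_hom: "\<lbrakk>f \<in> hom C A B; g \<in> hom C A' B'\<rbrakk> \<Longrightarrow> f \<otimes> g \<in> hom C (A \<odot> A') (B \<odot> B')"
    and tensor_id: "\<lbrakk>A \<in> Obj C; B \<in> Obj C\<rbrakk> \<Longrightarrow> Ident C A \<otimes> Ident C B = Ident C (A \<odot> B)"
    and tensor_comp: "\<lbrakk>f \<in> hom C A B; g \<in> hom C B D; f' \<in> hom C A' B'; g' \<in> hom C B' D'\<rbrakk>
      \<Longrightarrow> (g \<cdot> f) \<otimes> (g' \<cdot> f') = (g \<otimes> g') \<cdot> (f \<otimes> f')"
    and assoc_hom: "\<lbrakk>A \<in> Obj C; B \<in> Obj C; D \<in> Obj C\<rbrakk>
      \<Longrightarrow> Assoc C A B D \<in> hom C ((A \<odot> B) \<odot> D) (A \<odot> (B \<odot> D))"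
    and assoc_iso: "\<lbrakk>A \<in> Obj C; B \<in> Obj C; D \<in> Obj C\<rbrakk> \<Longrightarrow> is_iso C (Assoc C A B D)"
    and assoc_natural: "\<lbrakk>f \<in> hom C A A'; g \<in> hom C B B'; h \<in> hom C D D'\<rbrakk>
      \<Longrightarrow> Assoc C A' B' D' \<cdot> ((f \<otimes> g) \<otimes> h) = (f \<otimes> (g \<otimes> h)) \<cdot> Assoc C A B D"
    and lunit_hom: "A \<in> Obj C \<Longrightarrow> Lunit C A \<in> hom C (Unit C \<odot> A) A"
    and lunit_iso: "A \<in> Obj C \<Longrightarrow> is_iso C (Lunit C A)"
    and lunit_natural: "f \<in> hom C A B \<Longrightarrow> Lunit C B \<cdot> (Ident C (Unit C) \<otimes> f) = f \<cdot> Lunit C A"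
    and runit_hom: "A \<in> Obj C \<Longrightarrow> Runit C A \<in> hom C (A \<odot> Unit C) A"
    and runit_iso: "A \<in> Obj C \<Longrightarrow> is_iso C (Runit C A)"
    and runit_natural: "f \<in> hom C A B \<Longrightarrow> Runit C B \<cdot> (f \<otimes> Ident C (Unit C)) = f \<cdot> Runit C A"
    and pentagon: "\<lbrakk>A \<in> Obj C; B \<in> Obj C; D \<in> Obj C; E \<in> Obj C\<rbrakk>
      \<Longrightarrow> Assoc C A B (D \<odot> E) \<cdot> Assoc C (A \<odot> B) D E
        = (Ident C A \<otimes> Assoc C B D E) \<cdot> Assoc C A (B \<odot> D) E \<cdot> (Assoc C A B D \<otimes> Ident C E)"
    and triangle: "\<lbrakk>A \<in> Obj C; B \<in> Obj C\<rbrakk>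
      \<Longrightarrow> (Ident C A \<otimes> Lunit C B) \<cdot> Assoc C A (Unit C) B = Runit C A \<otimes> Ident C B"
    and sym_hom: "\<lbrakk>A \<in> Obj C; B \<in> Obj C\<rbrakk> \<Longrightarrow> Sym C A B \<in> hom C (A \<odot> B) (B \<odot> A)"
    and sym_natural: "\<lbrakk>f \<in> hom C A A'; g \<in> hom C B B'\<rbrakk>
      \<Longrightarrow> Sym C A' B' \<cdot> (f \<otimes> g) = (g \<otimes> f) \<cdot> Sym C A B"
    and sym_involution: "\<lbrakk>A \<in> Obj C; B \<in> Obj C\<rbrakk> \<Longrightarrow> Sym C B A \<cdot> Sym C A B = Ident C (A \<odot> B)"
    and hexagon: "\<lbrakk>A \<in> Obj C; B \<in> Obj C; D \<in> Obj C\<rbrakk>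
      \<Longrightarrow> Assoc C B D A \<cdot> Sym C A (B \<odot> D) \<cdot> Assoc C A B D
        = (Ident C B \<otimes> Sym C A D) \<cdot> Assoc C B A D \<cdot> (Sym C A B \<otimes> Ident C D)"

text \<open>The canonical map \<open>(A \<odot> B) \<odot> (D \<odot> E) \<rightarrow> (A \<odot> D) \<odot> (B \<odot> E)\<close>.\<close>

definition mid_swap :: "('o, 'm, 'z) smc_struct_scheme \<Rightarrow> 'o \<Rightarrow> 'o \<Rightarrow> 'o \<Rightarrow> 'o \<Rightarrow> 'm" where
  "mid_swap C A B D E =
     inv_arr C (Assoc C A D (B \<odot>\<^bsub>C\<^esub> E)) \<cdot>\<^bsub>C\<^esub> (Ident C A \<otimes>\<^bsub>C\<^esub> Assoc C D B E)
     \<cdot>\<^bsub>C\<^esub> (Ident C A \<otimes>\<^bsub>C\<^esub> (Sym C B D \<otimes>\<^bsub>C\<^esub> Ident C E))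
     \<cdot>\<^bsub>C\<^esub> (Ident C A \<otimes>\<^bsub>C\<^esub> inv_arr C (Assoc C B D E)) \<cdot>\<^bsub>C\<^esub> Assoc C A B (D \<odot>\<^bsub>C\<^esub> E)"


section \<open>Markov categories\<close>

record ('o, 'm) markov_struct = "('o, 'm) smc_struct" +
  Copy :: "'o \<Rightarrow> 'm"
  Del :: "'o \<Rightarrow> 'm"

locale markov_category = symmetric_monoidal_category C
  for C :: "('o, 'm, 'z) markov_struct_scheme" (structure) +
  assumes unit_terminal: "A \<in> Obj C \<Longrightarrow> \<exists>!f. f \<in> hom C A (Unit C)"
    and copy_hom: "A \<in> Obj C \<Longrightarrow> Copy C A \<in> hom C A (A \<odot> A)"
    and del_hom: "A \<in> Obj C \<Longrightarrow> Del C A \<in> hom C A (Unit C)"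
    and copy_coassoc: "A \<in> Obj C
      \<Longrightarrow> Assoc C A A A \<cdot> (Copy C A \<otimes> Ident C A) \<cdot> Copy C A = (Ident C A \<otimes> Copy C A) \<cdot> Copy C A"
    and copy_counit_left: "A \<in> Obj C \<Longrightarrow> Lunit C A \<cdot> (Del C A \<otimes> Ident C A) \<cdot> Copy C A = Ident C A"
    and copy_counit_right: "A \<in> Obj C \<Longrightarrow> Runit C A \<cdot> (Ident C A \<otimes> Del C A) \<cdot> Copy C A = Ident C A"
    and copy_comm: "A \<in> Obj C \<Longrightarrow> Sym C A A \<cdot> Copy C A = Copy C A"
    and copy_tensor: "\<lbrakk>A \<in> Obj C; B \<in> Obj C\<rbrakk>
      \<Longrightarrow> Copy C (A \<odot> B) = mid_swap C A A B B \<cdot> (Copy C A \<otimes> Copy C B)"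
    and del_tensor: "\<lbrakk>A \<in> Obj C; B \<in> Obj C\<rbrakk>
      \<Longrightarrow> Del C (A \<odot> B) = Lunit C (Unit C) \<cdot> (Del C A \<otimes> Del C B)"
    and copy_unit: "Copy C (Unit C) = inv_arr C (Lunit C (Unit C))"
    and del_unit: "Del C (Unit C) = Ident C (Unit C)"

definition proj_left :: "('o, 'm, 'z) markov_struct_scheme \<Rightarrow> 'o \<Rightarrow> 'o \<Rightarrow> 'm" where
  "proj_left C X Y = Runit C X \<cdot>\<^bsub>C\<^esub> (Ident C X \<otimes>\<^bsub>C\<^esub> Del C Y)"

definition pairing :: "('o, 'm, 'z) markov_struct_scheme \<Rightarrow> 'm \<Rightarrow> 'm \<Rightarrow> 'm" where
  "pairing C f g = (f \<otimes>\<^bsub>C\<^esub> g) \<cdot>\<^bsub>C\<^esub> Copy C (Dom C f)"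

text \<open>Triple tensor products are bracketed to the left: for \<open>f : A \<rightarrow> X\<close>, \<open>g : A \<rightarrow> Y\<close>,
  \<open>h : A \<rightarrow> Z\<close> the triple below is a morphism \<open>A \<rightarrow> (X \<odot> Y) \<odot> Z\<close>.\<close>

definition tripling :: "('o, 'm, 'z) markov_struct_scheme \<Rightarrow> 'm \<Rightarrow> 'm \<Rightarrow> 'm \<Rightarrow> 'm" where
  "tripling C f g h = ((f \<otimes>\<^bsub>C\<^esub> g) \<otimes>\<^bsub>C\<^esub> h)
     \<cdot>\<^bsub>C\<^esub> (Copy C (Dom C f) \<otimes>\<^bsub>C\<^esub> Ident C (Dom C f)) \<cdot>\<^bsub>C\<^esub> Copy C (Dom C f)"

locale markov_category_with_conditionals = markov_category C
  for C :: "('o, 'm, 'z) markov_struct_scheme" (structure) +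
  assumes conditionals: "\<lbrakk>A \<in> Obj C; X \<in> Obj C; Y \<in> Obj C; f \<in> hom C A (X \<odot> Y)\<rbrakk>
    \<Longrightarrow> \<exists>k \<in> hom C (X \<odot> A) Y.
          f = (Ident C X \<otimes> k) \<cdot> Assoc C X X A \<cdot> (Copy C X \<otimes> Ident C A)
                \<cdot> ((proj_left C X Y \<cdot> f) \<otimes> Ident C A) \<cdot> Copy C A"

definition states :: "('o, 'm, 'z) markov_struct_scheme \<Rightarrow> 'o \<Rightarrow> 'm set" where
  "states C X = hom C (Unit C) X"

definition as_eq :: "('o, 'm, 'z) markov_struct_scheme \<Rightarrow> 'm \<Rightarrow> 'm \<Rightarrow> 'm \<Rightarrow> bool" where
  "as_eq C p f g \<longleftrightarrow>
     pairing C (Ident C (Dom C f)) f \<cdot>\<^bsub>C\<^esub> p = pairing C (Ident C (Dom C g)) g \<cdot>\<^bsub>C\<^esub> p"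

definition as_det :: "('o, 'm, 'z) markov_struct_scheme \<Rightarrow> 'm \<Rightarrow> 'm \<Rightarrow> bool" where
  "as_det C p f \<longleftrightarrow>
     as_eq C p (Copy C (Cod C f) \<cdot>\<^bsub>C\<^esub> f) ((f \<otimes>\<^bsub>C\<^esub> f) \<cdot>\<^bsub>C\<^esub> Copy C (Dom C f))"


section \<open>Probability spaces and sample spaces\<close>

text \<open>A morphism \<open>a \<rightarrow> b\<close> of probability spaces is a triple \<open>(a, b, F)\<close>, where \<open>F\<close> is an
  almost sure equality class of state-preserving maps \<open>a \<rightarrow> b\<close>, given as a set of such maps.\<close>

definition ps_maps ::
  "('o, 'm, 'z) markov_struct_scheme \<Rightarrow> 'o \<times> 'm \<Rightarrow> 'o \<times> 'm \<Rightarrow> 'm set" where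
  "ps_maps C a b = {f \<in> hom C (fst a) (fst b). f \<cdot>\<^bsub>C\<^esub> snd a = snd b}"

definition as_class ::
  "('o, 'm, 'z) markov_struct_scheme \<Rightarrow> 'o \<times> 'm \<Rightarrow> 'o \<times> 'm \<Rightarrow> 'm \<Rightarrow> 'm set" where
  "as_class C a b f = {g \<in> ps_maps C a b. as_eq C (snd a) f g}"

type_synonym ('o, 'm) ps_arrow = "('o \<times> 'm) \<times> ('o \<times> 'm) \<times> 'm set"

definition arrow_reps :: "('o, 'm) ps_arrow \<Rightarrow> 'm set" where
  "arrow_reps \<phi> = snd (snd \<phi>)"

text \<open>The composite of two classes consists of all maps almost surely equal to a composite of
  representatives. In the presence of conditionals this is a single class.\<close>

definition prob_cat ::
  "('o, 'm, 'z) markov_struct_scheme \<Rightarrow> ('o \<times> 'm, ('o, 'm) ps_arrow) cat_struct" where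
  "prob_cat C =
    \<lparr> Obj = {(X, p). X \<in> Obj C \<and> p \<in> states C X},
      Arr = {(a, b, F) | a b F. fst a \<in> Obj C \<and> snd a \<in> states C (fst a)
               \<and> fst b \<in> Obj C \<and> snd b \<in> states C (fst b)
               \<and> (\<exists>f \<in> ps_maps C a b. F = as_class C a b f)},
      Dom = (\<lambda>(a, b, F). a),
      Cod = (\<lambda>(a, b, F). b),
      Ident = (\<lambda>a. (a, a, as_class C a a (Ident C (fst a)))),
      Comp = (\<lambda>(b', c, G) (a, b, F). (a, c, \<Union>f \<in> F. \<Union>g \<in> G. as_class C a c (g \<cdot>\<^bsub>C\<^esub> f))) \<rparr>"

text \<open>Almost sure determinism depends only on the class, so one representative is tested.\<close>

definition sample_cat ::
  "('o, 'm, 'z) markov_struct_scheme \<Rightarrow> ('o \<times> 'm, ('o, 'm) ps_arrow) cat_struct" where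
  "sample_cat C = (prob_cat C)
     \<lparr> Arr := {\<phi> \<in> Arr (prob_cat C).
                 \<exists>f \<in> arrow_reps \<phi>. as_det C (snd (Dom (prob_cat C) \<phi>)) f} \<rparr>"

definition commutative_square ::
  "('o, 'm, 'z) cat_struct_scheme \<Rightarrow> 'm \<Rightarrow> 'm \<Rightarrow> 'm \<Rightarrow> 'm \<Rightarrow> bool" where
  "commutative_square S f g u v \<longleftrightarrow>
     (\<exists>\<Omega> X Y Z. f \<in> hom S \<Omega> X \<and> g \<in> hom S \<Omega> Y \<and> u \<in> hom S X Z \<and> v \<in> hom S Y Z)
     \<and> u \<cdot>\<^bsub>S\<^esub> f = v \<cdot>\<^bsub>S\<^esub> g"

text \<open>The state \<open>\<langle>f,d,g\<rangle> \<circ> p\<^sub>\<Omega>\<close> does not depend on the representatives of the classes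
  \<open>f\<close>, \<open>d\<close>, \<open>g\<close>, so it suffices to refer to some representatives.\<close>

definition independent_square ::
  "('o, 'm, 'z) markov_struct_scheme \<Rightarrow> ('o, 'm) ps_arrow \<Rightarrow> ('o, 'm) ps_arrow
     \<Rightarrow> ('o, 'm) ps_arrow \<Rightarrow> ('o, 'm) ps_arrow \<Rightarrow> bool" where
  "independent_square C f g u v \<longleftrightarrow>
     commutative_square (sample_cat C) f g u v \<and>
     (let S = sample_cat C; d = u \<cdot>\<^bsub>S\<^esub> f;
          (\<Omega>, p\<^sub>\<Omega>) = Dom S f; (X, p\<^sub>X) = Cod S f; (Y, p\<^sub>Y) = Cod S g; (Z, p\<^sub>Z) = Cod S u
      in \<exists>\<phi> \<in> hom C Z X. \<exists>\<psi> \<in> hom C Z Y.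
           \<exists>f\<^sub>0 \<in> arrow_reps f. \<exists>d\<^sub>0 \<in> arrow_reps d. \<exists>g\<^sub>0 \<in> arrow_reps g.
             tripling C f\<^sub>0 d\<^sub>0 g\<^sub>0 \<cdot>\<^bsub>C\<^esub> p\<^sub>\<Omega> = tripling C \<phi> (Ident C Z) \<psi> \<cdot>\<^bsub>C\<^esub> p\<^sub>Z)"

end

theory Submission
  imports Defs
begin

text \<open>Independence of the square says that the joint law of \<open>(f, d, g)\<close> under \<open>p\<^sub>\<Omega>\<close> is the law of
  \<open>(\<phi>, id, \<psi>)\<close> under \<open>p\<^sub>Z\<close>. The canonical isomorphism
  \<open>(X \<odot> Z) \<odot> Y \<rightarrow> (Y \<odot> Z) \<odot> X\<close> that reverses the order of the factors turns these two states into the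
  joint laws of \<open>(g, d, f)\<close> and of \<open>(\<psi>, id, \<phi>)\<close>, so the same representatives of the classes, with
  \<open>\<phi>\<close> and \<open>\<psi>\<close> exchanged, witness independence of the transposed square; the diagonal is unchanged
  because \<open>u f = v g\<close>.

  What has to be shown is that reversal takes \<open>\<langle>f, g, h\<rangle>\<close> to \<open>\<langle>h, g, f\<rangle>\<close>. Naturality of the
  coherence maps reduces this to the threefold copy map, and there it is cocommutativity (used
  twice) together with coassociativity (\<open>reverse_copy3\<close>, \<open>reverse_tripling\<close>). The associator
  bringing the reversed triple back to left bracketing is kept on the other side of the equation
  and cancelled at the end (\<open>assoc_cancel\<close>), so no calculation has to handle its inverse.\<close>

context symmetric_monoidal_category
begin

lemma assoc_cancel:
  assumes "B \<in> Obj C" "D \<in> Obj C" "E \<in> Obj C"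
    and r: "r \<in> hom C A ((B \<odot> D) \<odot> E)" and s: "s \<in> hom C A ((B \<odot> D) \<odot> E)"
    and eq: "Assoc C B D E \<cdot> r = Assoc C B D E \<cdot> s"
  shows "r = s"
proof -
  let ?a = "Assoc C B D E"
  have a: "?a \<in> hom C ((B \<odot> D) \<odot> E) (B \<odot> (D \<odot> E))"
    by (rule assoc_hom) fact+
  obtain b where b: "b \<in> hom C (B \<odot> (D \<odot> E)) ((B \<odot> D) \<odot> E)"
    and ba: "b \<cdot> ?a = Ident C ((B \<odot> D) \<odot> E)"
    using assoc_iso[OF assms(1-3)] a unfolding is_iso_def inverse_arrows_def hom_def by auto
  have "r = b \<cdot> (?a \<cdot> r)"
    using comp_assoc[OF r a b] id_left[OF r] ba by simp
  also have "\<dots> = s"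
    using comp_assoc[OF s a b] id_left[OF s] ba eq by simp
  finally show ?thesis .
qed

text \<open>The target \<open>D \<odot> (B \<odot> A)\<close> is bracketed to the right: reaching \<open>(D \<odot> B) \<odot> A\<close> would take
  an inverse associator.\<close>

definition reverse :: "'o \<Rightarrow> 'o \<Rightarrow> 'o \<Rightarrow> 'm" where
  "reverse A B D = (Ident C D \<otimes> Sym C A B) \<cdot> Sym C (A \<odot> B) D"

lemma reverse_hom:
  assumes "A \<in> Obj C" "B \<in> Obj C" "D \<in> Obj C"
  shows "reverse A B D \<in> hom C ((A \<odot> B) \<odot> D) (D \<odot> (B \<odot> A))"
  unfolding reverse_def
  by (intro comp_hom[OF sym_hom tensor_hom] tensor_obj id_hom sym_hom assms)

lemma hom_obj:
  assumes "f \<in> hom C A B"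
  shows "A \<in> Obj C" "B \<in> Obj C"
  using assms dom_obj cod_obj unfolding hom_def by auto

lemma reverse_natural:
  assumes f: "f \<in> hom C A X" and g: "g \<in> hom C B Y" and h: "h \<in> hom C D Z"
  shows "reverse X Y Z \<cdot> ((f \<otimes> g) \<otimes> h) = (h \<otimes> (g \<otimes> f)) \<cdot> reverse A B D"
proof -
  note objs = hom_obj[OF f] hom_obj[OF g] hom_obj[OF h]
  note fg = tensor_hom[OF f g] and gf = tensor_hom[OF g f]
  note swXY = sym_hom[OF objs(2) objs(4)] and swAB = sym_hom[OF objs(1) objs(3)]
  note t1 = tensor_hom[OF fg h]
    and t2 = sym_hom[OF tensor_obj[OF objs(2) objs(4)] objs(6)]
    and t3 = tensor_hom[OF id_hom[OF objs(6)] swXY]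
    and t4 = sym_hom[OF tensor_obj[OF objs(1) objs(3)] objs(5)]
    and t5 = tensor_hom[OF h fg]
    and t6 = tensor_hom[OF id_hom[OF objs(5)] swAB]
    and t7 = tensor_hom[OF h gf]
  have "(Ident C Z \<otimes> Sym C X Y) \<cdot> (h \<otimes> (f \<otimes> g)) = h \<otimes> (Sym C X Y \<cdot> (f \<otimes> g))"
    using tensor_comp[OF h id_hom[OF objs(6)] fg swXY] id_left[OF h] by simp
  also have "\<dots> = h \<otimes> ((g \<otimes> f) \<cdot> Sym C A B)"
    by (simp only: sym_natural[OF f g])
  also have "\<dots> = (h \<otimes> (g \<otimes> f)) \<cdot> (Ident C D \<otimes> Sym C A B)"
    using tensor_comp[OF id_hom[OF objs(5)] h swAB gf] id_right[OF h] by simp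
  finally have inner: "(Ident C Z \<otimes> Sym C X Y) \<cdot> (h \<otimes> (f \<otimes> g))
    = (h \<otimes> (g \<otimes> f)) \<cdot> (Ident C D \<otimes> Sym C A B)" .
  have "reverse X Y Z \<cdot> ((f \<otimes> g) \<otimes> h)
      = (Ident C Z \<otimes> Sym C X Y) \<cdot> ((h \<otimes> (f \<otimes> g)) \<cdot> Sym C (A \<odot> B) D)"
    unfolding reverse_def by (simp only: comp_assoc[OF t1 t2 t3] sym_natural[OF fg h])
  also have "\<dots> = ((h \<otimes> (g \<otimes> f)) \<cdot> (Ident C D \<otimes> Sym C A B)) \<cdot> Sym C (A \<odot> B) D"
    by (simp only: comp_assoc[OF t4 t5 t3, symmetric] inner)
  also have "\<dots> = (h \<otimes> (g \<otimes> f)) \<cdot> reverse A B D"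
    unfolding reverse_def by (rule comp_assoc[OF t4 t6 t7])
  finally show ?thesis .
qed

end

context markov_category
begin

lemma copy3_hom:
  assumes "A \<in> Obj C"
  shows "(Copy C A \<otimes> Ident C A) \<cdot> Copy C A \<in> hom C A ((A \<odot> A) \<odot> A)"
  by (rule comp_hom[OF copy_hom tensor_hom[OF copy_hom id_hom]]) fact+

text \<open>The outer swap is absorbed by the outer copy and the inner swap by the inner copy; what is
  left is the right-bracketed threefold copy, to which the left-bracketed one is associated.\<close>

lemma reverse_copy3:
  assumes A: "A \<in> Obj C"
  shows "reverse A A A \<cdot> ((Copy C A \<otimes> Ident C A) \<cdot> Copy C A)
    = Assoc C A A A \<cdot> ((Copy C A \<otimes> Ident C A) \<cdot> Copy C A)"
proof -
  note c = copy_hom[OF A] and i = id_hom[OF A] and s = sym_hom[OF A A]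
  note ci = tensor_hom[OF c i] and ic = tensor_hom[OF i c] and iS = tensor_hom[OF i s]
  note S = sym_hom[OF tensor_obj[OF A A] A]
  have inner: "(Ident C A \<otimes> Sym C A A) \<cdot> (Ident C A \<otimes> Copy C A) = Ident C A \<otimes> Copy C A"
    using tensor_comp[OF i i c s] id_left[OF i] copy_comm[OF A] by simp
  have "Sym C (A \<odot> A) A \<cdot> ((Copy C A \<otimes> Ident C A) \<cdot> Copy C A)
      = (Ident C A \<otimes> Copy C A) \<cdot> (Sym C A A \<cdot> Copy C A)"
    by (simp only: comp_assoc[OF c ci S, symmetric] sym_natural[OF c i] comp_assoc[OF c s ic])
  also have "\<dots> = (Ident C A \<otimes> Copy C A) \<cdot> Copy C A"
    by (simp only: copy_comm[OF A])
  finally have "reverse A A A \<cdot> ((Copy C A \<otimes> Ident C A) \<cdot> Copy C A)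
      = (Ident C A \<otimes> Sym C A A) \<cdot> ((Ident C A \<otimes> Copy C A) \<cdot> Copy C A)"
    unfolding reverse_def by (simp only: comp_assoc[OF copy3_hom[OF A] S iS])
  also have "\<dots> = (Ident C A \<otimes> Copy C A) \<cdot> Copy C A"
    by (simp only: comp_assoc[OF c ic iS, symmetric] inner)
  finally show ?thesis
    by (simp only: copy_coassoc[OF A])
qed

lemma tripling_hom:
  assumes f: "f \<in> hom C A X" and g: "g \<in> hom C A Y" and h: "h \<in> hom C A Z"
  shows "tripling C f g h \<in> hom C A ((X \<odot> Y) \<odot> Z)"
proof -
  have "Dom C f = A" using f unfolding hom_def by simp
  then show ?thesis
    unfolding tripling_def
    using comp_hom[OF copy3_hom[OF hom_obj(1)[OF f]] tensor_hom[OF tensor_hom[OF f g] h]] by simp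
qed

lemma reverse_tripling:
  assumes f: "f \<in> hom C A X" and g: "g \<in> hom C A Y" and h: "h \<in> hom C A Z"
  shows "reverse X Y Z \<cdot> tripling C f g h = Assoc C Z Y X \<cdot> tripling C h g f"
proof -
  let ?K = "(Copy C A \<otimes> Ident C A) \<cdot> Copy C A"
  note A = hom_obj(1)[OF f] and X = hom_obj(2)[OF f]
    and Y = hom_obj(2)[OF g] and Z = hom_obj(2)[OF h]
  note K = copy3_hom[OF A]
  note fgh = tensor_hom[OF tensor_hom[OF f g] h] and hgf = tensor_hom[OF tensor_hom[OF h g] f]
    and hgf' = tensor_hom[OF h tensor_hom[OF g f]]
  have dom: "Dom C f = A" "Dom C h = A"
    using f h unfolding hom_def by auto
  have "reverse X Y Z \<cdot> tripling C f g h = ((h \<otimes> (g \<otimes> f)) \<cdot> reverse A A A) \<cdot> ?K"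
    unfolding tripling_def dom
    by (simp only: comp_assoc[OF K fgh reverse_hom[OF X Y Z], symmetric] reverse_natural[OF f g h])
  also have "\<dots> = (h \<otimes> (g \<otimes> f)) \<cdot> (Assoc C A A A \<cdot> ?K)"
    by (simp only: comp_assoc[OF K reverse_hom[OF A A A] hgf'] reverse_copy3[OF A])
  also have "\<dots> = (Assoc C Z Y X \<cdot> ((h \<otimes> g) \<otimes> f)) \<cdot> ?K"
    by (simp only: comp_assoc[OF K assoc_hom[OF A A A] hgf', symmetric] assoc_natural[OF h g f])
  also have "\<dots> = Assoc C Z Y X \<cdot> tripling C h g f"
    unfolding tripling_def dom by (rule comp_assoc[OF K hgf assoc_hom[OF Z Y X]])
  finally show ?thesis .
qed

text \<open>The two triples may live on different objects, as in independence, where one law is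
  described from \<open>\<Omega>\<close> and the other from \<open>Z\<close>.\<close>

lemma tripling_state_reverse:
  assumes f: "f \<in> hom C A X" and g: "g \<in> hom C A Y" and h: "h \<in> hom C A Z"
    and f': "f' \<in> hom C B X" and g': "g' \<in> hom C B Y" and h': "h' \<in> hom C B Z"
    and p: "p \<in> hom C E A" and q: "q \<in> hom C E B"
    and eq: "tripling C f g h \<cdot> p = tripling C f' g' h' \<cdot> q"
  shows "tripling C h g f \<cdot> p = tripling C h' g' f' \<cdot> q"
proof -
  note X = hom_obj(2)[OF f] and Y = hom_obj(2)[OF g] and Z = hom_obj(2)[OF h]
  note R = reverse_hom[OF X Y Z] and a = assoc_hom[OF Z Y X]
  note t = tripling_hom[OF f g h] tripling_hom[OF h g f]
  note t' = tripling_hom[OF f' g' h'] tripling_hom[OF h' g' f']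
  have "Assoc C Z Y X \<cdot> (tripling C h g f \<cdot> p) = reverse X Y Z \<cdot> (tripling C f g h \<cdot> p)"
    by (simp only: comp_assoc[OF p t(2) a, symmetric] comp_assoc[OF p t(1) R, symmetric]
        reverse_tripling[OF f g h])
  also have "\<dots> = reverse X Y Z \<cdot> (tripling C f' g' h' \<cdot> q)"
    by (simp only: eq)
  also have "\<dots> = Assoc C Z Y X \<cdot> (tripling C h' g' f' \<cdot> q)"
    by (simp only: comp_assoc[OF q t'(2) a, symmetric] comp_assoc[OF q t'(1) R, symmetric]
        reverse_tripling[OF f' g' h'])
  finally show ?thesis
    by (rule assoc_cancel[OF Z Y X comp_hom[OF p t(2)] comp_hom[OF q t'(2)]])
qed

end

lemma sample_hom_states:
  assumes "f \<in> hom (sample_cat C) a b"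
  shows "snd a \<in> states C (fst a)" "snd b \<in> states C (fst b)"
  using assms unfolding hom_def sample_cat_def prob_cat_def by auto

lemma sample_hom_reps:
  assumes "f \<in> hom (sample_cat C) a b"
  shows "arrow_reps f \<subseteq> hom C (fst a) (fst b)"
  using assms unfolding hom_def sample_cat_def prob_cat_def arrow_reps_def as_class_def ps_maps_def
  by auto

lemma sample_hom_dom_cod:
  assumes "f \<in> hom (sample_cat C) a b"
  shows "Dom (sample_cat C) f = a" "Cod (sample_cat C) f = b"
  using assms unfolding hom_def by auto

lemma sample_comp_reps:
  assumes "f \<in> hom (sample_cat C) a b" "u \<in> hom (sample_cat C) b c"
  shows "arrow_reps (u \<cdot>\<^bsub>sample_cat C\<^esub> f) \<subseteq> hom C (fst a) (fst c)"
  using assms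
  unfolding hom_def sample_cat_def prob_cat_def arrow_reps_def as_class_def ps_maps_def
  by auto

theorem proposition17:
  fixes C :: "('o, 'm) markov_struct"
    and \<Omega> X Y Z :: "'o \<times> 'm"
    and f g u v :: "('o, 'm) ps_arrow"
  assumes "markov_category_with_conditionals C"
    and "f \<in> hom (sample_cat C) \<Omega> X"
    and "g \<in> hom (sample_cat C) \<Omega> Y"
    and "u \<in> hom (sample_cat C) X Z"
    and "v \<in> hom (sample_cat C) Y Z"
    and "u \<cdot>\<^bsub>sample_cat C\<^esub> f = v \<cdot>\<^bsub>sample_cat C\<^esub> g"
    and "independent_square C f g u v"
  shows "independent_square C g f v u"
proof -
  interpret markov_category_with_conditionals C by fact
  note [simp] = sample_hom_dom_cod[OF assms(2)] sample_hom_dom_cod[OF assms(3)]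
    sample_hom_dom_cod[OF assms(4)] sample_hom_dom_cod[OF assms(5)]
  obtain \<phi> \<psi> f\<^sub>0 d\<^sub>0 g\<^sub>0
    where \<phi>: "\<phi> \<in> hom C (fst Z) (fst X)" and \<psi>: "\<psi> \<in> hom C (fst Z) (fst Y)"
      and reps: "f\<^sub>0 \<in> arrow_reps f" "d\<^sub>0 \<in> arrow_reps (u \<cdot>\<^bsub>sample_cat C\<^esub> f)" "g\<^sub>0 \<in> arrow_reps g"
      and eq: "tripling C f\<^sub>0 d\<^sub>0 g\<^sub>0 \<cdot>\<^bsub>C\<^esub> snd \<Omega> = tripling C \<phi> (Ident C (fst Z)) \<psi> \<cdot>\<^bsub>C\<^esub> snd Z"
    using assms(7) unfolding independent_square_def Let_def by (auto simp: case_prod_beta)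
  have homs: "f\<^sub>0 \<in> hom C (fst \<Omega>) (fst X)" "d\<^sub>0 \<in> hom C (fst \<Omega>) (fst Z)"
    "g\<^sub>0 \<in> hom C (fst \<Omega>) (fst Y)"
    using reps sample_hom_reps[OF assms(2)] sample_hom_reps[OF assms(3)]
      sample_comp_reps[OF assms(2) assms(4)] by auto
  have p: "snd \<Omega> \<in> hom C (Unit C) (fst \<Omega>)" and q: "snd Z \<in> hom C (Unit C) (fst Z)"
    using sample_hom_states(1)[OF assms(2)] sample_hom_states(2)[OF assms(4)]
    unfolding states_def by auto
  have "tripling C g\<^sub>0 d\<^sub>0 f\<^sub>0 \<cdot>\<^bsub>C\<^esub> snd \<Omega> = tripling C \<psi> (Ident C (fst Z)) \<phi> \<cdot>\<^bsub>C\<^esub> snd Z"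
    by (rule tripling_state_reverse[OF homs \<phi> id_hom[OF hom_obj(1)[OF \<phi>]] \<psi> p q eq])
  moreover have "d\<^sub>0 \<in> arrow_reps (v \<cdot>\<^bsub>sample_cat C\<^esub> g)"
    using reps(2) assms(6) by simp
  moreover have "commutative_square (sample_cat C) g f v u"
    unfolding commutative_square_def using assms(2-5) assms(6)[symmetric] by blast
  ultimately show ?thesis
    unfolding independent_square_def Let_def using \<phi> \<psi> reps(1,3)
    by (simp add: case_prod_beta) blast
qed

end
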